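(* Fix $N\in\mathbb N$ and a commutative ring $k$ (by default $k=\mathbb C$). (I) The charge-conserving matrices form a (diagonal, i.e. with endomorphisms only) monoidal subcategory $\mathsf{Match}^N$ of $\mathsf{Mat}^N$. (II) Let $w\in\Sigma_N$. The monoidal functor $f^w:\mathsf{Mat}^N\to\mathsf{Mat}^N$ restricts to a monoidal functor $f^w:\mathsf{Match}^N\to\mathsf{Match}^N$. (III) For each $M\le N$ and each injective function $\psi:\{1,\dots,M\}\to\{1,\dots,N\}$ there is a monoidal functor $f^\psi:\mathsf{Match}^N\to\mathsf{Match}^M$ given on morphisms by $f^\psi(\mathbf a)_{v,w}=\mathbf a_{\psi v,\psi w}$ for $\mathbf a\in\mathsf{Match}^N(m,m)$ and $v,w\in\{1,\dots,M\}^m$.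
   Context: $\mathsf{Mat}$ is the strict monoidal category of matrices over $k$, with objects natural numbers, composition matrix multiplication, and tensor product the Kronecker product (on objects, multiplication). $\mathsf{Mat}^N$ is the monoidal subcategory generated by the object $N$, with objects relabelled by $\mathbb N_0$ so that $\mathsf{Mat}^N(a,b)$ is the set of $N^a\times N^b$ matrices; rows (columns) are indexed by words in $\{1,\dots,N\}^a$ (resp. $\{1,\dots,N\}^b$), so that $(\mathbf a\otimes\mathbf b)_{iI,jJ}=\mathbf a_{i,j}\mathbf b_{I,J}$, where $iI$ denotes concatenation of words. A matrix $\alpha\in\mathsf{Mat}^N(m,m)$ is charge-conserving if $\alpha_{i,j}\neq0$ (with $i,j\in\{1,\dots,N\}^m$) implies that the word $j$ is obtained from the word $i$ by a permutation of places. For $w\in\Sigma_N$ with permutation matrix $\rho(w)$, the functor $f^w$ is the identity on objects and takes $T\in\mathsf{Mat}^N(a,b)$ to $\rho(w)^{\otimes a}\,T\,(\rho(w)^{-1})^{\otimes b}$. For a word $v=v_1\cdots v_m$, $\psi v=\psi(v_1)\cdots\psi(v_m)$. *)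

theory Defs
  imports Complex_Main "HOL-Combinatorics.Permutations"
begin

section \<open>Strict monoidal categories\<close>

text \<open>
  Hom-sets are indexed by source and target and need not be disjoint, so composition and the
  tensor product of morphisms take the objects involved as arguments. Composition is in
  diagrammatic order: \<open>Comp C a b c f g\<close> is \<open>f : a \<rightarrow> b\<close> followed by \<open>g : b \<rightarrow> c\<close>, which for matrices
  is the product \<open>f g\<close> since \<open>Hom a b\<close> consists of matrices with rows indexed by \<open>a\<close>. Likewise
  \<open>Tensor C a b c d f g\<close> is \<open>f \<otimes> g : a \<otimes> c \<rightarrow> b \<otimes> d\<close> for \<open>f : a \<rightarrow> b\<close> and \<open>g : c \<rightarrow> d\<close>.
\<close>

record ('o, 'm) moncat =
  Obj :: "'o set"
  Hom :: "'o \<Rightarrow> 'o \<Rightarrow> 'm set"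
  Ident :: "'o \<Rightarrow> 'm"
  Comp :: "'o \<Rightarrow> 'o \<Rightarrow> 'o \<Rightarrow> 'm \<Rightarrow> 'm \<Rightarrow> 'm"
  Unit :: "'o"
  Tensor_obj :: "'o \<Rightarrow> 'o \<Rightarrow> 'o"
  Tensor :: "'o \<Rightarrow> 'o \<Rightarrow> 'o \<Rightarrow> 'o \<Rightarrow> 'm \<Rightarrow> 'm \<Rightarrow> 'm"

locale strict_monoidal_category =
  fixes C :: "('o, 'm) moncat"
  assumes Ident_in: "a \<in> Obj C \<Longrightarrow> Ident C a \<in> Hom C a a"
    and Comp_in: "\<lbrakk>a \<in> Obj C; b \<in> Obj C; c \<in> Obj C; f \<in> Hom C a b; g \<in> Hom C b c\<rbrakk>
      \<Longrightarrow> Comp C a b c f g \<in> Hom C a c"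
    and Comp_Ident_left: "\<lbrakk>a \<in> Obj C; b \<in> Obj C; f \<in> Hom C a b\<rbrakk>
      \<Longrightarrow> Comp C a a b (Ident C a) f = f"
    and Comp_Ident_right: "\<lbrakk>a \<in> Obj C; b \<in> Obj C; f \<in> Hom C a b\<rbrakk>
      \<Longrightarrow> Comp C a b b f (Ident C b) = f"
    and Comp_assoc: "\<lbrakk>a \<in> Obj C; b \<in> Obj C; c \<in> Obj C; d \<in> Obj C;
        f \<in> Hom C a b; g \<in> Hom C b c; h \<in> Hom C c d\<rbrakk>
      \<Longrightarrow> Comp C a c d (Comp C a b c f g) h = Comp C a b d f (Comp C b c d g h)"
    and Unit_in: "Unit C \<in> Obj C"
    and Tensor_obj_in: "\<lbrakk>a \<in> Obj C; b \<in> Obj C\<rbrakk> \<Longrightarrow> Tensor_obj C a b \<in> Obj C"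
    and Tensor_obj_Unit_left: "a \<in> Obj C \<Longrightarrow> Tensor_obj C (Unit C) a = a"
    and Tensor_obj_Unit_right: "a \<in> Obj C \<Longrightarrow> Tensor_obj C a (Unit C) = a"
    and Tensor_obj_assoc: "\<lbrakk>a \<in> Obj C; b \<in> Obj C; c \<in> Obj C\<rbrakk>
      \<Longrightarrow> Tensor_obj C (Tensor_obj C a b) c = Tensor_obj C a (Tensor_obj C b c)"
    and Tensor_in: "\<lbrakk>a \<in> Obj C; b \<in> Obj C; c \<in> Obj C; d \<in> Obj C; f \<in> Hom C a b; g \<in> Hom C c d\<rbrakk>
      \<Longrightarrow> Tensor C a b c d f g \<in> Hom C (Tensor_obj C a c) (Tensor_obj C b d)"
    and Tensor_Ident: "\<lbrakk>a \<in> Obj C; b \<in> Obj C\<rbrakk>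
      \<Longrightarrow> Tensor C a a b b (Ident C a) (Ident C b) = Ident C (Tensor_obj C a b)"
    and Tensor_Comp: "\<lbrakk>a \<in> Obj C; b \<in> Obj C; c \<in> Obj C; a' \<in> Obj C; b' \<in> Obj C; c' \<in> Obj C;
        f \<in> Hom C a b; g \<in> Hom C b c; f' \<in> Hom C a' b'; g' \<in> Hom C b' c'\<rbrakk>
      \<Longrightarrow> Tensor C a c a' c' (Comp C a b c f g) (Comp C a' b' c' f' g') =
          Comp C (Tensor_obj C a a') (Tensor_obj C b b') (Tensor_obj C c c')
            (Tensor C a b a' b' f f') (Tensor C b c b' c' g g')"
    and Tensor_Unit_left: "\<lbrakk>a \<in> Obj C; b \<in> Obj C; f \<in> Hom C a b\<rbrakk>
      \<Longrightarrow> Tensor C (Unit C) (Unit C) a b (Ident C (Unit C)) f = f"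
    and Tensor_Unit_right: "\<lbrakk>a \<in> Obj C; b \<in> Obj C; f \<in> Hom C a b\<rbrakk>
      \<Longrightarrow> Tensor C a b (Unit C) (Unit C) f (Ident C (Unit C)) = f"
    and Tensor_assoc: "\<lbrakk>a \<in> Obj C; b \<in> Obj C; c \<in> Obj C; a' \<in> Obj C; b' \<in> Obj C; c' \<in> Obj C;
        f \<in> Hom C a a'; g \<in> Hom C b b'; h \<in> Hom C c c'\<rbrakk>
      \<Longrightarrow> Tensor C (Tensor_obj C a b) (Tensor_obj C a' b') c c' (Tensor C a a' b b' f g) h =
          Tensor C a a' (Tensor_obj C b c) (Tensor_obj C b' c') f (Tensor C b b' c c' g h)"

locale monoidal_subcategory =
  sub: strict_monoidal_category D + ambient: strict_monoidal_category C
  for D C :: "('o, 'm) moncat" +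
  assumes Obj_sub: "Obj D \<subseteq> Obj C"
    and Hom_sub: "\<lbrakk>a \<in> Obj D; b \<in> Obj D\<rbrakk> \<Longrightarrow> Hom D a b \<subseteq> Hom C a b"
    and Ident_eq: "a \<in> Obj D \<Longrightarrow> Ident D a = Ident C a"
    and Comp_eq: "\<lbrakk>a \<in> Obj D; b \<in> Obj D; c \<in> Obj D; f \<in> Hom D a b; g \<in> Hom D b c\<rbrakk>
      \<Longrightarrow> Comp D a b c f g = Comp C a b c f g"
    and Unit_eq: "Unit D = Unit C"
    and Tensor_obj_eq: "\<lbrakk>a \<in> Obj D; b \<in> Obj D\<rbrakk> \<Longrightarrow> Tensor_obj D a b = Tensor_obj C a b"
    and Tensor_eq: "\<lbrakk>a \<in> Obj D; b \<in> Obj D; c \<in> Obj D; d \<in> Obj D; f \<in> Hom D a b; g \<in> Hom D c d\<rbrakk>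
      \<Longrightarrow> Tensor D a b c d f g = Tensor C a b c d f g"

definition diagonal :: "('o, 'm) moncat \<Rightarrow> bool" where
  "diagonal C \<longleftrightarrow> (\<forall>a\<in>Obj C. \<forall>b\<in>Obj C. a \<noteq> b \<longrightarrow> Hom C a b = {})"

text \<open>\<open>F a b\<close> is the action of the functor on morphisms \<open>a \<rightarrow> b\<close>.\<close>

locale strict_monoidal_functor =
  source: strict_monoidal_category C + target: strict_monoidal_category D
  for C :: "('o, 'm) moncat" and D :: "('p, 'n) moncat" +
  fixes Fo :: "'o \<Rightarrow> 'p" and F :: "'o \<Rightarrow> 'o \<Rightarrow> 'm \<Rightarrow> 'n"
  assumes map_Obj: "a \<in> Obj C \<Longrightarrow> Fo a \<in> Obj D"
    and map_Hom: "\<lbrakk>a \<in> Obj C; b \<in> Obj C; f \<in> Hom C a b\<rbrakk> \<Longrightarrow> F a b f \<in> Hom D (Fo a) (Fo b)"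
    and map_Ident: "a \<in> Obj C \<Longrightarrow> F a a (Ident C a) = Ident D (Fo a)"
    and map_Comp: "\<lbrakk>a \<in> Obj C; b \<in> Obj C; c \<in> Obj C; f \<in> Hom C a b; g \<in> Hom C b c\<rbrakk>
      \<Longrightarrow> F a c (Comp C a b c f g) = Comp D (Fo a) (Fo b) (Fo c) (F a b f) (F b c g)"
    and map_Unit: "Fo (Unit C) = Unit D"
    and map_Tensor_obj: "\<lbrakk>a \<in> Obj C; b \<in> Obj C\<rbrakk>
      \<Longrightarrow> Fo (Tensor_obj C a b) = Tensor_obj D (Fo a) (Fo b)"
    and map_Tensor: "\<lbrakk>a \<in> Obj C; b \<in> Obj C; c \<in> Obj C; d \<in> Obj C; f \<in> Hom C a b; g \<in> Hom C c d\<rbrakk>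
      \<Longrightarrow> F (Tensor_obj C a c) (Tensor_obj C b d) (Tensor C a b c d f g) =
          Tensor D (Fo a) (Fo b) (Fo c) (Fo d) (F a b f) (F c d g)"

section \<open>Matrices indexed by words\<close>

definition words :: "nat \<Rightarrow> nat \<Rightarrow> nat list set" where
  "words N m = {v. set v \<subseteq> {1..N} \<and> length v = m}"

text \<open>
  The sort \<open>{comm_ring, comm_monoid_mult}\<close> used below is that of commutative rings with 1;
  unlike \<open>comm_ring_1\<close> it does not exclude the zero ring.

  An \<open>N\<^sup>a \<times> N\<^sup>b\<close> matrix is a function on pairs of words that vanishes outside
  \<open>words N a \<times> words N b\<close>, so that equality of morphisms is equality of functions.
\<close>

type_synonym 'k word_matrix = "nat list \<Rightarrow> nat list \<Rightarrow> 'k"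

definition matrices :: "nat \<Rightarrow> nat \<Rightarrow> nat \<Rightarrow> ('k::zero) word_matrix set" where
  "matrices N a b = {A. \<forall>i j. (i, j) \<notin> words N a \<times> words N b \<longrightarrow> A i j = 0}"

definition id_matrix :: "nat \<Rightarrow> nat \<Rightarrow> ('k::{comm_ring, comm_monoid_mult}) word_matrix" where
  "id_matrix N a = (\<lambda>i j. if i \<in> words N a \<and> i = j then 1 else 0)"

definition matrix_prod ::
    "nat \<Rightarrow> nat \<Rightarrow> ('k::{comm_ring, comm_monoid_mult}) word_matrix \<Rightarrow> 'k word_matrix \<Rightarrow> 'k word_matrix" where
  "matrix_prod N b A B = (\<lambda>i j. \<Sum>l\<in>words N b. A i l * B l j)"

text \<open>
  Here \<open>a\<close> and \<open>b\<close> are the lengths of the row and column words of the first factor. For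
  arguments in \<open>matrices N a b\<close> and \<open>matrices N c d\<close> the result vanishes outside
  \<open>words N (a + c) \<times> words N (b + d)\<close>.
\<close>

definition kronecker ::
    "nat \<Rightarrow> nat \<Rightarrow> ('k::{comm_ring, comm_monoid_mult}) word_matrix \<Rightarrow> 'k word_matrix \<Rightarrow> 'k word_matrix" where
  "kronecker a b A B = (\<lambda>v w. A (take a v) (take b w) * B (drop a v) (drop b w))"

lemma kronecker_append:
  "length i = a \<Longrightarrow> length j = b \<Longrightarrow> kronecker a b A B (i @ I) (j @ J) = A i j * B I J"
  by (simp add: kronecker_def)

type_synonym 'k matrix_category = "(nat, 'k word_matrix) moncat"

definition Mat :: "nat \<Rightarrow> ('k::{comm_ring, comm_monoid_mult}) matrix_category" where
  "Mat N = \<lparr>Obj = UNIV,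
            Hom = matrices N,
            Ident = id_matrix N,
            Comp = (\<lambda>a b c. matrix_prod N b),
            Unit = 0,
            Tensor_obj = (+),
            Tensor = (\<lambda>a b c d. kronecker a b)\<rparr>"

definition charge_conserving :: "nat \<Rightarrow> nat \<Rightarrow> ('k::zero) word_matrix \<Rightarrow> bool" where
  "charge_conserving N m A \<longleftrightarrow>
    (\<forall>i\<in>words N m. \<forall>j\<in>words N m. A i j \<noteq> 0 \<longrightarrow> (\<exists>\<sigma>. \<sigma> permutes {..<m} \<and> j = permute_list \<sigma> i))"

definition Match :: "nat \<Rightarrow> ('k::{comm_ring, comm_monoid_mult}) matrix_category" where
  "Match N = (Mat N)\<lparr>Hom := (\<lambda>a b. if a = b then {A \<in> Hom (Mat N) a a. charge_conserving N a A} else {})\<rparr>"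

section \<open>The action of the symmetric group\<close>

text \<open>
  The matrix of \<open>e\<^sub>j \<mapsto> e\<^bsub>w j\<^esub>\<close>, as a morphism \<open>1 \<rightarrow> 1\<close> (rows and columns are one-letter words).
\<close>

definition perm_matrix :: "nat \<Rightarrow> (nat \<Rightarrow> nat) \<Rightarrow> ('k::{comm_ring, comm_monoid_mult}) word_matrix" where
  "perm_matrix N w = (\<lambda>i j. if i \<in> words N 1 \<and> j \<in> words N 1 \<and> i = map w j then 1 else 0)"

definition inverse_matrix ::
    "nat \<Rightarrow> nat \<Rightarrow> ('k::{comm_ring, comm_monoid_mult}) word_matrix \<Rightarrow> 'k word_matrix" where
  "inverse_matrix N a A = (THE B. B \<in> matrices N a a \<and>
     matrix_prod N a A B = id_matrix N a \<and> matrix_prod N a B A = id_matrix N a)"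

text \<open>The tensor power of a morphism \<open>1 \<rightarrow> 1\<close>.\<close>

primrec tensor_power ::
    "nat \<Rightarrow> ('k::{comm_ring, comm_monoid_mult}) word_matrix \<Rightarrow> nat \<Rightarrow> 'k word_matrix" where
  "tensor_power N A 0 = id_matrix N 0"
| "tensor_power N A (Suc m) = kronecker 1 1 A (tensor_power N A m)"

definition f_perm ::
    "nat \<Rightarrow> (nat \<Rightarrow> nat) \<Rightarrow> nat \<Rightarrow> nat \<Rightarrow> ('k::{comm_ring, comm_monoid_mult}) word_matrix \<Rightarrow> 'k word_matrix" where
  "f_perm N w a b T =
     matrix_prod N b
       (matrix_prod N a (tensor_power N (perm_matrix N w) a) T)
       (tensor_power N (inverse_matrix N 1 (perm_matrix N w)) b)"

end

(* Charge conservation of A says that A i j can only be nonzero when i and j have the same multiset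
   of letters. This condition is stable under products and tensor products, which gives (I).
   Conjugation by the tensor powers of the permutation matrix of w sends T to the matrix with
   entries T at (w^-1 i, w^-1 j), so (II) and (III) both concern pulling a matrix back along an
   injective relabelling of letters. The only issue is compatibility with composition: the sum over
   all intermediate words l of A(psi i, l) B(l, psi j) must reduce to the words l in the image of
   psi. This is automatic if psi is onto, and in general follows from charge conservation, because l
   then has the same letters as psi i. *)

theory Submission imports Defs begin

section \<open>Words\<close>

lemma finite_words [simp]: "finite (words N m)"
  unfolding words_def by (rule finite_lists_length_eq) simp

lemma length_words: "v \<in> words N m \<Longrightarrow> length v = m"
  by (simp add: words_def)

text \<open>The lengths of the two pieces determine \<open>length v\<close>: \<open>take a v\<close>
  has length \<open>a\<close> only if \<open>v\<close> is long enough. Membership can thus be tested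
  piecewise, the way \<open>kronecker\<close> cuts its indices.\<close>

lemma words_add_iff: "v \<in> words N (a + b) \<longleftrightarrow> take a v \<in> words N a \<and> drop a v \<in> words N b"
proof -
  have "set v = set (take a v) \<union> set (drop a v)"
    by (metis append_take_drop_id set_append)
  moreover have "length v = a + b \<longleftrightarrow> length (take a v) = a \<and> length (drop a v) = b"
    by auto
  ultimately show ?thesis
    unfolding words_def by auto
qed

lemma take_drop_eq_iff: "take a v = take a w \<and> drop a v = drop a w \<longleftrightarrow> v = w"
  by (metis append_take_drop_id)

text \<open>Cutting a word after \<open>a\<close> letters is a bijection inverse to concatenation.
  This is what the interchange law needs.\<close>

lemma sum_words_add:
  "(\<Sum>v\<in>words N (a + b). f (take a v) (drop a v)) = (\<Sum>x\<in>words N a. \<Sum>y\<in>words N b. f x y)"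
proof -
  have "(\<Sum>v\<in>words N (a + b). f (take a v) (drop a v))
      = (\<Sum>(x, y)\<in>words N a \<times> words N b. f x y)"
    by (rule sum.reindex_bij_witness[where j = "\<lambda>v. (take a v, drop a v)" and i = "\<lambda>(x, y). x @ y"])
      (auto simp: words_add_iff length_words)
  then show ?thesis
    by (simp add: sum.cartesian_product)
qed

lemma map_words: "\<psi> \<in> {1..M} \<rightarrow> {1..N} \<Longrightarrow> v \<in> words M m \<Longrightarrow> map \<psi> v \<in> words N m"
  unfolding words_def by fastforce

lemma map_words_eq_iff:
  assumes "inj_on \<psi> {1..M}" "v \<in> words M m" "w \<in> words M m"
  shows "map \<psi> v = map \<psi> w \<longleftrightarrow> v = w"
  using assms by (intro inj_on_map_eq_map) (auto simp: words_def intro: inj_on_subset)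

section \<open>The monoidal category of matrices\<close>

lemma Mat_simps [simp]:
  "Obj (Mat N) = UNIV" "Hom (Mat N) = matrices N" "Ident (Mat N) = id_matrix N"
  "Comp (Mat N) a b c = matrix_prod N b" "Unit (Mat N) = 0" "Tensor_obj (Mat N) = (+)"
  "Tensor (Mat N) a b c d = kronecker a b"
  by (simp_all add: Mat_def)

lemma matrices_eq_0: "A \<in> matrices N a b \<Longrightarrow> i \<notin> words N a \<or> j \<notin> words N b \<Longrightarrow> A i j = 0"
  by (auto simp: matrices_def)

lemma id_matrix_in: "id_matrix N a \<in> matrices N a a"
  by (auto simp: matrices_def id_matrix_def)

lemma matrix_prod_in:
  "A \<in> matrices N a b \<Longrightarrow> B \<in> matrices N b c \<Longrightarrow> matrix_prod N b A B \<in> matrices N a c"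
  by (auto simp: matrices_def matrix_prod_def intro!: sum.neutral)

lemma kronecker_in:
  assumes "A \<in> matrices N a b" "B \<in> matrices N c d"
  shows "kronecker a b A B \<in> matrices N (a + c) (b + d)"
  using assms by (auto simp: matrices_def kronecker_def words_add_iff)

text \<open>The delta sum leaves \<open>A i j\<close> if \<open>i\<close> is a word and 0 otherwise;
  in the second case \<open>A i j\<close> is 0 too, which is where membership in
  \<open>matrices\<close> enters.\<close>

lemma matrix_prod_id_left:
  assumes "A \<in> matrices N a b"
  shows "matrix_prod N a (id_matrix N a) A = A"
proof (intro ext)
  fix i j
  have "matrix_prod N a (id_matrix N a) A i j = (\<Sum>l\<in>words N a. if l = i then A i j else 0)"
    unfolding matrix_prod_def id_matrix_def by (intro sum.cong) auto
  then show "matrix_prod N a (id_matrix N a) A i j = A i j"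
    using matrices_eq_0[OF assms] by auto
qed

lemma matrix_prod_id_right:
  assumes "A \<in> matrices N a b"
  shows "matrix_prod N b A (id_matrix N b) = A"
proof (intro ext)
  fix i j
  have "matrix_prod N b A (id_matrix N b) i j = (\<Sum>l\<in>words N b. if l = j then A i j else 0)"
    unfolding matrix_prod_def id_matrix_def by (intro sum.cong) auto
  then show "matrix_prod N b A (id_matrix N b) i j = A i j"
    using matrices_eq_0[OF assms] by auto
qed

lemma matrix_prod_assoc:
  "matrix_prod N c (matrix_prod N b A B) C = matrix_prod N b A (matrix_prod N c B C)"
proof (intro ext)
  fix i j
  have "matrix_prod N c (matrix_prod N b A B) C i j
      = (\<Sum>l\<in>words N c. \<Sum>k\<in>words N b. A i k * B k l * C l j)"
    by (simp add: matrix_prod_def sum_distrib_right)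
  also have "\<dots> = (\<Sum>k\<in>words N b. \<Sum>l\<in>words N c. A i k * B k l * C l j)"
    by (rule sum.swap)
  also have "\<dots> = matrix_prod N b A (matrix_prod N c B C) i j"
    by (simp add: matrix_prod_def sum_distrib_left mult.assoc)
  finally show "matrix_prod N c (matrix_prod N b A B) C i j
      = matrix_prod N b A (matrix_prod N c B C) i j" .
qed

lemma kronecker_id: "kronecker a a (id_matrix N a) (id_matrix N b) = id_matrix N (a + b)"
proof (intro ext)
  fix v w
  show "kronecker a a (id_matrix N a) (id_matrix N b) v w = id_matrix N (a + b) v w"
    using take_drop_eq_iff[of a v w] by (auto simp: kronecker_def id_matrix_def words_add_iff)
qed

text \<open>Interchange law: commutativity of the ring swaps the two middle factors, and the double
  sum over pieces becomes one sum over words of length \<open>b + b'\<close>.\<close>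

lemma kronecker_matrix_prod:
  "kronecker a c (matrix_prod N b A B) (matrix_prod N b' A' B')
    = matrix_prod N (b + b') (kronecker a b A A') (kronecker b c B B')"
proof (intro ext)
  fix v w
  have "kronecker a c (matrix_prod N b A B) (matrix_prod N b' A' B') v w
      = (\<Sum>x\<in>words N b. \<Sum>y\<in>words N b'.
          A (take a v) x * A' (drop a v) y * (B x (take c w) * B' y (drop c w)))"
    by (simp add: kronecker_def matrix_prod_def sum_product mult_ac)
  also have "\<dots> = matrix_prod N (b + b') (kronecker a b A A') (kronecker b c B B') v w"
    by (simp add: kronecker_def matrix_prod_def sum_words_add[symmetric])
  finally show "kronecker a c (matrix_prod N b A B) (matrix_prod N b' A' B') v w
      = matrix_prod N (b + b') (kronecker a b A A') (kronecker b c B B') v w" .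
qed

lemma kronecker_unit_left: "kronecker 0 0 (id_matrix N 0) A = A"
  by (intro ext) (simp add: kronecker_def id_matrix_def words_def)

lemma kronecker_unit_right:
  assumes "A \<in> matrices N a b"
  shows "kronecker a b A (id_matrix N 0) = A"
proof (intro ext)
  fix v w
  show "kronecker a b A (id_matrix N 0) v w = A v w"
  \<comment> \<open>If both words fit, cutting leaves them whole with empty remainders. An overlong
    word has a nonempty remainder, where \<open>id_matrix N 0\<close> vanishes just as
    \<open>A\<close> does.\<close>
  proof (cases "length v \<le> a \<and> length w \<le> b")
    case True
    then show ?thesis
      by (simp add: kronecker_def id_matrix_def words_def)
  next
    case False
    then have "A v w = 0"
      using matrices_eq_0[OF assms] length_words by fastforce
    with False show ?thesis
      by (auto simp: kronecker_def id_matrix_def words_def)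
  qed
qed

lemma kronecker_assoc:
  "kronecker (a + b) (a' + b') (kronecker a a' A B) C = kronecker a a' A (kronecker b b' B C)"
  by (intro ext) (simp add: kronecker_def drop_take add.commute mult.assoc)

lemma strict_monoidal_category_Mat: "strict_monoidal_category (Mat N)"
  by unfold_locales
    (simp_all add: id_matrix_in matrix_prod_in kronecker_in matrix_prod_id_left
      matrix_prod_id_right matrix_prod_assoc kronecker_id kronecker_matrix_prod
      kronecker_unit_left kronecker_unit_right kronecker_assoc add.assoc)

section \<open>Charge-conserving matrices\<close>

text \<open>Words are rearrangements of each other exactly when their multisets of letters agree.
  Equality of multisets is visibly transitive and compatible with concatenation and
  relabelling.\<close>

lemma charge_conserving_iff_mset:
  "charge_conserving N m A \<longleftrightarrow> (\<forall>i\<in>words N m. \<forall>j\<in>words N m. A i j \<noteq> 0 \<longrightarrow> mset i = mset j)"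
proof -
  have "(\<exists>\<sigma>. \<sigma> permutes {..<m} \<and> j = permute_list \<sigma> i) \<longleftrightarrow> mset i = mset j"
    if "i \<in> words N m" for i j
    using length_words[OF that] by (metis mset_eq_permutation mset_permute_list)
  then show ?thesis
    unfolding charge_conserving_def by auto
qed

lemma charge_conserving_id: "charge_conserving N m (id_matrix N m)"
  by (auto simp: charge_conserving_iff_mset id_matrix_def)

lemma charge_conserving_matrix_prod:
  assumes A: "charge_conserving N m A" and B: "charge_conserving N m B"
  shows "charge_conserving N m (matrix_prod N m A B)"
  unfolding charge_conserving_iff_mset
proof (intro ballI impI)
  fix i j
  assume ij: "i \<in> words N m" "j \<in> words N m" and "matrix_prod N m A B i j \<noteq> 0"
  then obtain l where l: "l \<in> words N m" and "A i l * B l j \<noteq> 0"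
    unfolding matrix_prod_def by (meson sum.not_neutral_contains_not_neutral)
  \<comment> \<open>A nonzero product has nonzero factors in any ring, even one with zero
    divisors.\<close>
  then have "A i l \<noteq> 0" "B l j \<noteq> 0"
    by auto
  with A B ij l show "mset i = mset j"
    unfolding charge_conserving_iff_mset by metis
qed

lemma charge_conserving_kronecker:
  assumes A: "charge_conserving N a A" and B: "charge_conserving N b B"
  shows "charge_conserving N (a + b) (kronecker a a A B)"
  unfolding charge_conserving_iff_mset
proof (intro ballI impI)
  fix i j
  assume ij: "i \<in> words N (a + b)" "j \<in> words N (a + b)" and "kronecker a a A B i j \<noteq> 0"
  then have "A (take a i) (take a j) \<noteq> 0" "B (drop a i) (drop a j) \<noteq> 0"
    by (auto simp: kronecker_def)
  with A B ij have "mset (take a i) = mset (take a j)" "mset (drop a i) = mset (drop a j)"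
    unfolding charge_conserving_iff_mset words_add_iff by blast+
  then show "mset i = mset j"
    by (metis append_take_drop_id mset_append)
qed

text \<open>The equational axioms are inherited because the operations are those of
  \<open>C\<close>; only closure of the smaller hom-sets must be checked.\<close>

lemma monoidal_subcategory_Hom_update:
  fixes C :: "('o, 'm) moncat"
  assumes C: "strict_monoidal_category C"
    and sub: "\<And>a b. H a b \<subseteq> Hom C a b"
    and Ident: "\<And>a. a \<in> Obj C \<Longrightarrow> Ident C a \<in> H a a"
    and Comp: "\<And>a b c f g. \<lbrakk>a \<in> Obj C; b \<in> Obj C; c \<in> Obj C; f \<in> H a b; g \<in> H b c\<rbrakk>
      \<Longrightarrow> Comp C a b c f g \<in> H a c"
    and Tensor: "\<And>a b c d f g. \<lbrakk>a \<in> Obj C; b \<in> Obj C; c \<in> Obj C; d \<in> Obj C; f \<in> H a b; g \<in> H c d\<rbrakk>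
      \<Longrightarrow> Tensor C a b c d f g \<in> H (Tensor_obj C a c) (Tensor_obj C b d)"
  shows "monoidal_subcategory (C\<lparr>Hom := H\<rparr>) C"
proof -
  interpret strict_monoidal_category C by (fact C)
  note mem = subsetD[OF sub]
  show ?thesis
    by unfold_locales
      (simp_all add: Ident Comp Tensor sub mem Comp_Ident_left Comp_Ident_right Comp_assoc
        Unit_in Tensor_obj_in Tensor_obj_Unit_left Tensor_obj_Unit_right Tensor_obj_assoc
        Tensor_Ident Tensor_Comp Tensor_Unit_left Tensor_Unit_right Tensor_assoc)
qed

definition match_hom ::
    "nat \<Rightarrow> nat \<Rightarrow> nat \<Rightarrow> ('k::{comm_ring, comm_monoid_mult}) word_matrix set" where
  "match_hom N a b = (if a = b then {A \<in> matrices N a a. charge_conserving N a A} else {})"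

lemma match_hom_iff:
  "A \<in> match_hom N a b \<longleftrightarrow> b = a \<and> A \<in> matrices N a a \<and> charge_conserving N a A"
  by (auto simp: match_hom_def)

lemma Match_eq: "Match N = (Mat N)\<lparr>Hom := match_hom N\<rparr>"
  by (simp add: Match_def match_hom_def fun_eq_iff)

lemma monoidal_subcategory_Match: "monoidal_subcategory (Match N) (Mat N)"
  unfolding Match_eq
  by (rule monoidal_subcategory_Hom_update)
    (auto simp: match_hom_iff strict_monoidal_category_Mat id_matrix_in matrix_prod_in kronecker_in
      charge_conserving_id charge_conserving_matrix_prod charge_conserving_kronecker)

lemma diagonal_Match: "diagonal (Match N)"
  by (auto simp: diagonal_def Match_eq match_hom_def)

section \<open>Relabelling letters\<close>

text \<open>The map of (III), set to 0 off words so that the result is a morphism. With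
  \<open>inv w\<close> for \<psi> it will also turn out to be the map of (II).\<close>

definition relabel ::
    "nat \<Rightarrow> (nat \<Rightarrow> nat) \<Rightarrow> nat \<Rightarrow> nat \<Rightarrow> ('k::{comm_ring, comm_monoid_mult}) word_matrix \<Rightarrow> 'k word_matrix"
  where "relabel M \<psi> a b A =
    (\<lambda>v w. if v \<in> words M a \<and> w \<in> words M b then A (map \<psi> v) (map \<psi> w) else 0)"

lemma relabel_in: "relabel M \<psi> a b A \<in> matrices M a b"
  by (auto simp: relabel_def matrices_def)

text \<open>Injectivity keeps the off-diagonal entries zero.\<close>

lemma relabel_id:
  assumes "\<psi> \<in> {1..M} \<rightarrow> {1..N}" "inj_on \<psi> {1..M}"
  shows "relabel M \<psi> a a (id_matrix N a) = id_matrix M a"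
  using map_words[OF assms(1)] map_words_eq_iff[OF assms(2)]
  by (intro ext) (auto simp: relabel_def id_matrix_def)

lemma relabel_kronecker:
  "relabel M \<psi> (a + c) (b + d) (kronecker a b A B)
    = kronecker a b (relabel M \<psi> a b A) (relabel M \<psi> c d B)"
  by (intro ext) (auto simp: relabel_def kronecker_def words_add_iff take_map drop_map)

text \<open>\<open>supp\<close> confines the nonzero entries of the relevant rows of
  \<open>A\<close> to words spelt in the image of \<psi>. It is the common form of the two cases in
  use: \<psi> onto, or \<open>A\<close> charge-conserving.\<close>

lemma relabel_matrix_prod:
  assumes \<psi>: "\<psi> \<in> {1..M} \<rightarrow> {1..N}" and inj: "inj_on \<psi> {1..M}"
    and supp: "\<And>v l. \<lbrakk>v \<in> words M a; l \<in> words N b; A (map \<psi> v) l \<noteq> 0\<rbrakk> \<Longrightarrow> set l \<subseteq> \<psi> ` {1..M}"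
  shows "relabel M \<psi> a c (matrix_prod N b A B)
    = matrix_prod M b (relabel M \<psi> a b A) (relabel M \<psi> b c B)"
proof (intro ext)
  fix v w
  show "relabel M \<psi> a c (matrix_prod N b A B) v w
    = matrix_prod M b (relabel M \<psi> a b A) (relabel M \<psi> b c B) v w"
  proof (cases "v \<in> words M a \<and> w \<in> words M c")
    case True
    have zero: "A (map \<psi> v) l * B l (map \<psi> w) = 0" if "l \<in> words N b - map \<psi> ` words M b" for l
    proof (rule ccontr)
      assume "A (map \<psi> v) l * B l (map \<psi> w) \<noteq> 0"
      then have "A (map \<psi> v) l \<noteq> 0"
        by auto
      then have "set l \<subseteq> \<psi> ` {1..M}"
        using supp True that by blast
      then have "l \<in> map \<psi> ` lists {1..M}"
        by (simp add: lists_image[symmetric] in_lists_conv_set subset_iff)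
      with that show False
        by (auto simp: words_def)
    qed
    have "relabel M \<psi> a c (matrix_prod N b A B) v w
        = (\<Sum>l\<in>words N b. A (map \<psi> v) l * B l (map \<psi> w))"
      using True by (simp add: relabel_def matrix_prod_def)
    also have "\<dots> = (\<Sum>l\<in>map \<psi> ` words M b. A (map \<psi> v) l * B l (map \<psi> w))"
      using map_words[OF \<psi>] zero by (intro sum.mono_neutral_right) auto
    also have "\<dots> = (\<Sum>l\<in>words M b. A (map \<psi> v) (map \<psi> l) * B (map \<psi> l) (map \<psi> w))"
      using map_words_eq_iff[OF inj] by (subst sum.reindex) (auto intro: inj_onI)
    also have "\<dots> = matrix_prod M b (relabel M \<psi> a b A) (relabel M \<psi> b c B) v w"
      using True by (simp add: relabel_def matrix_prod_def)
    finally show ?thesis .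
  next
    case False
    then show ?thesis
      by (auto simp: relabel_def matrix_prod_def)
  qed
qed

lemma charge_conserving_relabel:
  assumes \<psi>: "\<psi> \<in> {1..M} \<rightarrow> {1..N}" and inj: "inj_on \<psi> {1..M}" and A: "charge_conserving N m A"
  shows "charge_conserving M m (relabel M \<psi> m m A)"
  unfolding charge_conserving_iff_mset
proof (intro ballI impI)
  fix v w
  assume vw: "v \<in> words M m" "w \<in> words M m" and "relabel M \<psi> m m A v w \<noteq> 0"
  then have "A (map \<psi> v) (map \<psi> w) \<noteq> 0"
    by (simp add: relabel_def)
  then have "mset (map \<psi> v) = mset (map \<psi> w)"
    using A vw map_words[OF \<psi>] unfolding charge_conserving_iff_mset by blast
  then have eq: "image_mset \<psi> (mset v) = image_mset \<psi> (mset w)"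
    by simp
  \<comment> \<open>Injectivity on the letters lets \<psi> be cancelled from the equality of
    multisets, by applying its inverse on the image.\<close>
  have inv: "image_mset (inv_into {1..M} \<psi>) (image_mset \<psi> (mset u)) = mset u"
    if "u \<in> words M m" for u
  proof -
    have "map (inv_into {1..M} \<psi>) (map \<psi> u) = u"
      using that inj by (auto simp: words_def subset_iff inv_into_f_f intro!: map_idI)
    then show ?thesis
      by (metis mset_map)
  qed
  show "mset v = mset w"
    using inv[OF vw(1)] inv[OF vw(2)] eq by simp
qed

text \<open>The hom-sets are left open so that one argument covers both all matrices with a
  bijective relabelling and charge-conserving matrices with an injective one.\<close>

lemma strict_monoidal_functor_relabel:
  fixes H K :: "nat \<Rightarrow> nat \<Rightarrow> ('k::{comm_ring, comm_monoid_mult}) word_matrix set"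
  assumes \<psi>: "\<psi> \<in> {1..M} \<rightarrow> {1..N}" and inj: "inj_on \<psi> {1..M}"
    and H: "strict_monoidal_category ((Mat N)\<lparr>Hom := H\<rparr>)"
    and K: "strict_monoidal_category ((Mat M)\<lparr>Hom := K\<rparr>)"
    and HK: "\<And>a b A. A \<in> H a b \<Longrightarrow> relabel M \<psi> a b A \<in> K a b"
    and supp: "\<And>a b A v l. \<lbrakk>A \<in> H a b; v \<in> words M a; l \<in> words N b; A (map \<psi> v) l \<noteq> 0\<rbrakk>
      \<Longrightarrow> set l \<subseteq> \<psi> ` {1..M}"
  shows "strict_monoidal_functor ((Mat N)\<lparr>Hom := H\<rparr>) ((Mat M)\<lparr>Hom := K\<rparr>) (\<lambda>m. m) (relabel M \<psi>)"
proof -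
  interpret source: strict_monoidal_category "(Mat N)\<lparr>Hom := H\<rparr>" by (fact H)
  interpret target: strict_monoidal_category "(Mat M)\<lparr>Hom := K\<rparr>" by (fact K)
  show ?thesis
    by unfold_locales
      (simp_all add: HK relabel_id[OF \<psi> inj] relabel_kronecker relabel_matrix_prod[OF \<psi> inj supp])
qed

lemma strict_monoidal_functor_relabel_Match:
  assumes \<psi>: "\<psi> \<in> {1..M} \<rightarrow> {1..N}" and inj: "inj_on \<psi> {1..M}"
  shows "strict_monoidal_functor (Match N) (Match M) (\<lambda>m. m) (relabel M \<psi>)"
  unfolding Match_eq
proof (rule strict_monoidal_functor_relabel[OF \<psi> inj])
  show "strict_monoidal_category ((Mat N)\<lparr>Hom := match_hom N\<rparr>)"
    "strict_monoidal_category ((Mat M)\<lparr>Hom := match_hom M\<rparr>)"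
    by (rule monoidal_subcategory.axioms(1)[OF monoidal_subcategory_Match, unfolded Match_eq])+
  show "relabel M \<psi> a b A \<in> match_hom M a b" if "A \<in> match_hom N a b" for a b and A :: "'a word_matrix"
    using that charge_conserving_relabel[OF \<psi> inj] by (auto simp: match_hom_iff relabel_in)
  show "set l \<subseteq> \<psi> ` {1..M}"
    if "A \<in> match_hom N a b" "v \<in> words M a" "l \<in> words N b" "A (map \<psi> v) l \<noteq> 0"
    for a b v l and A :: "'a word_matrix"
  proof -
    \<comment> \<open>Hom-sets are diagonal, so \<open>b = a\<close> and charge conservation of
      \<open>A\<close> applies to the pair \<open>map \<psi> v\<close>, \<open>l\<close>.\<close>
    have "mset (map \<psi> v) = mset l"
      using that map_words[OF \<psi> that(2)] unfolding match_hom_iff charge_conserving_iff_mset by blast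
    then have "set l = \<psi> ` set v"
      by (metis set_map set_mset_mset)
    then show ?thesis
      using that(2) by (auto simp: words_def)
  qed
qed

section \<open>Conjugation by permutation matrices\<close>

text \<open>The closed form of the \<open>a\<close>-th tensor power of
  \<open>perm_matrix N w\<close>: the permutation matrix of the letterwise action on words.\<close>

definition word_perm_matrix ::
    "nat \<Rightarrow> (nat \<Rightarrow> nat) \<Rightarrow> nat \<Rightarrow> ('k::{comm_ring, comm_monoid_mult}) word_matrix" where
  "word_perm_matrix N w a =
    (\<lambda>i j. if i \<in> words N a \<and> j \<in> words N a \<and> i = map w j then 1 else 0)"

lemma word_perm_matrix_in: "word_perm_matrix N w a \<in> matrices N a a"
  by (auto simp: word_perm_matrix_def matrices_def)

lemma perm_matrix_eq: "perm_matrix N w = word_perm_matrix N w 1"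
  by (simp add: perm_matrix_def word_perm_matrix_def)

text \<open>The action is letterwise, so \<open>i = map w j\<close> can be tested on the two pieces,
  and a product of indicators is the indicator of the conjunction.\<close>

lemma kronecker_word_perm_matrix:
  "kronecker a a (word_perm_matrix N w a) (word_perm_matrix N w b) = word_perm_matrix N w (a + b)"
proof (intro ext)
  fix i j
  have "take a i = map w (take a j) \<and> drop a i = map w (drop a j) \<longleftrightarrow> i = map w j"
    using take_drop_eq_iff[of a i "map w j"] by (simp only: take_map drop_map)
  then have iff: "(take a i \<in> words N a \<and> take a j \<in> words N a \<and> take a i = map w (take a j)) \<and>
      (drop a i \<in> words N b \<and> drop a j \<in> words N b \<and> drop a i = map w (drop a j)) \<longleftrightarrow>
      i \<in> words N (a + b) \<and> j \<in> words N (a + b) \<and> i = map w j"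
    unfolding words_add_iff by blast
  have mult: "(if P then 1 else 0) * (if Q then 1 else 0) = (if P \<and> Q then 1 else (0::'a))" for P Q
    by simp
  show "kronecker a a (word_perm_matrix N w a) (word_perm_matrix N w b) i j
      = (word_perm_matrix N w (a + b) i j :: 'a)"
    unfolding kronecker_def word_perm_matrix_def mult iff ..
qed

lemma tensor_power_perm_matrix: "tensor_power N (perm_matrix N w) a = word_perm_matrix N w a"
proof (induction a)
  case 0
  show ?case
    by (intro ext) (auto simp: word_perm_matrix_def id_matrix_def words_def)
next
  case (Suc a)
  show ?case
    using kronecker_word_perm_matrix[of 1 N w a, folded perm_matrix_eq] by (simp add: Suc)
qed

section \<open>Permutations acting on words, rows and columns\<close>

lemma permutes_funcset: "w permutes S \<Longrightarrow> w \<in> S \<rightarrow> S"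
  by (rule funcsetI) (rule iffD2[OF permutes_in_image])

lemma permutes_map_words: "w permutes {1..N} \<Longrightarrow> v \<in> words N m \<Longrightarrow> map w v \<in> words N m"
  by (rule map_words[OF permutes_funcset])

lemma eq_map_inv_iff:
  assumes "w permutes S"
  shows "v = map w u \<longleftrightarrow> u = map (inv w) v"
proof -
  have "map w (map (inv w) v) = v" "map (inv w) (map w u) = u"
    unfolding map_map permutes_inv_o[OF assms] by (rule list.map_id)+
  then show ?thesis
    by metis
qed

text \<open>Row \<open>i\<close> of the permutation matrix has its single 1 in column
  \<open>map (inv w) i\<close>.\<close>

lemma word_perm_matrix_prod_left:
  assumes w: "w permutes {1..N}" and i: "i \<in> words N a"
  shows "matrix_prod N a (word_perm_matrix N w a) A i j = A (map (inv w) i) j"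
proof -
  have "matrix_prod N a (word_perm_matrix N w a) A i j
      = (\<Sum>l\<in>words N a. if l = map (inv w) i then A l j else 0)"
    unfolding matrix_prod_def word_perm_matrix_def
    using i eq_map_inv_iff[OF w] by (intro sum.cong) auto
  then show ?thesis
    using permutes_map_words[OF permutes_inv[OF w] i] by simp
qed

text \<open>Column \<open>j\<close> has its single 1 in row \<open>map w j\<close>, so
  \<open>w\<close> itself appears here; the right factor of a conjugation is the matrix of
  \<open>inv w\<close>, which again gives \<open>inv w\<close>.\<close>

lemma word_perm_matrix_prod_right:
  assumes w: "w permutes {1..N}" and j: "j \<in> words N b"
  shows "matrix_prod N b A (word_perm_matrix N w b) i j = A i (map w j)"
proof -
  have "matrix_prod N b A (word_perm_matrix N w b) i j
      = (\<Sum>l\<in>words N b. if l = map w j then A i l else 0)"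
    unfolding matrix_prod_def word_perm_matrix_def using j by (intro sum.cong) auto
  then show ?thesis
    using permutes_map_words[OF w j] by simp
qed

lemma word_perm_matrix_inv_prod:
  assumes w: "w permutes {1..N}"
  shows "matrix_prod N a (word_perm_matrix N w a) (word_perm_matrix N (inv w) a) = id_matrix N a"
proof (intro ext)
  fix i j
  note inv = permutes_inv[OF w]
  show "matrix_prod N a (word_perm_matrix N w a) (word_perm_matrix N (inv w) a) i j
    = id_matrix N a i j"
  proof (cases "i \<in> words N a")
    case True
    have "map (inv w) i = map (inv w) j \<longleftrightarrow> i = j"
      using permutes_inj[OF inv] by (simp add: inj_map_eq_map)
    then show ?thesis
      using True permutes_map_words[OF inv True]
      unfolding word_perm_matrix_prod_left[OF w True]
      by (auto simp: word_perm_matrix_def id_matrix_def)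
  next
    case False
    then show ?thesis
      by (simp add: matrix_prod_def word_perm_matrix_def id_matrix_def)
  qed
qed

lemma inverse_perm_matrix:
  assumes w: "w permutes {1..N}"
  shows "inverse_matrix N 1 (perm_matrix N w) = perm_matrix N (inv w)"
  unfolding inverse_matrix_def perm_matrix_eq
proof (rule the_equality)
  let ?P = "word_perm_matrix N w 1" and ?Q = "word_perm_matrix N (inv w) 1"
  \<comment> \<open>The second identity is the first one for \<open>inv w\<close>, whose inverse is
    \<open>w\<close>.\<close>
  have PQ: "matrix_prod N 1 ?P ?Q = id_matrix N 1" and QP: "matrix_prod N 1 ?Q ?P = id_matrix N 1"
    using word_perm_matrix_inv_prod[OF w] word_perm_matrix_inv_prod[OF permutes_inv[OF w]]
    by (simp_all add: permutes_inv_inv[OF w])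
  then show "?Q \<in> matrices N 1 1 \<and> matrix_prod N 1 ?P ?Q = id_matrix N 1
      \<and> matrix_prod N 1 ?Q ?P = id_matrix N 1"
    by (simp add: word_perm_matrix_in)
  fix B :: "'a word_matrix"
  assume B: "B \<in> matrices N 1 1 \<and> matrix_prod N 1 ?P B = id_matrix N 1
      \<and> matrix_prod N 1 B ?P = id_matrix N 1"
  \<comment> \<open>Uniqueness, as required by the definite description: B = (QP)B = Q(PB) =
    Q.\<close>
  have "B = matrix_prod N 1 (matrix_prod N 1 ?Q ?P) B"
    unfolding QP using B by (metis matrix_prod_id_left)
  also have "\<dots> = matrix_prod N 1 ?Q (id_matrix N 1)"
    using B by (metis matrix_prod_assoc)
  also have "\<dots> = ?Q"
    by (rule matrix_prod_id_right) (rule word_perm_matrix_in)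
  finally show "B = ?Q" .
qed

text \<open>For a matrix outside \<open>matrices N a b\<close> both sides discard the entries not indexed by words.\<close>

lemma f_perm_eq_relabel:
  assumes w: "w permutes {1..N}"
  shows "f_perm N w = relabel N (inv w)"
proof (intro ext)
  fix a b i j and T :: "'a word_matrix"
  note inv = permutes_inv[OF w]
  have eq: "f_perm N w a b T = matrix_prod N b (matrix_prod N a (word_perm_matrix N w a) T)
      (word_perm_matrix N (inv w) b)"
    by (simp only: f_perm_def inverse_perm_matrix[OF w] tensor_power_perm_matrix)
  show "f_perm N w a b T i j = relabel N (inv w) a b T i j"
  proof (cases "i \<in> words N a \<and> j \<in> words N b")
    case True
    then show ?thesis
      by (simp add: eq relabel_def word_perm_matrix_prod_left[OF w]
          word_perm_matrix_prod_right[OF inv])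
  next
    case False
    then show ?thesis
      by (auto simp: eq relabel_def matrix_prod_def word_perm_matrix_def)
  qed
qed

text \<open>A permutation is onto the letters, so the support condition holds for every
  matrix.\<close>

lemma strict_monoidal_functor_relabel_Mat:
  assumes u: "u permutes {1..N}"
  shows "strict_monoidal_functor (Mat N) (Mat N) (\<lambda>m. m) (relabel N u)"
proof -
  \<comment> \<open>Replacing \<open>Hom\<close> by itself brings \<open>Mat N\<close> into the
    shape of the general result.\<close>
  have Mat: "(Mat N)\<lparr>Hom := matrices N\<rparr> = Mat N"
    by (simp add: Mat_def)
  have "u \<in> {1..N} \<rightarrow> {1..N}" "inj_on u {1..N}" "u ` {1..N} = {1..N}"
    by (rule permutes_funcset[OF u] permutes_inj_on[OF u] permutes_image[OF u])+
  then show ?thesis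
    using strict_monoidal_functor_relabel[of u N N "matrices N" "matrices N", unfolded Mat,
        OF _ _ strict_monoidal_category_Mat strict_monoidal_category_Mat relabel_in]
    by (simp add: words_def)
qed

theorem lemma3p7:
  fixes N :: nat
  shows
    "(monoidal_subcategory (Match N :: ('k::{comm_ring, comm_monoid_mult}) matrix_category) (Mat N)
      \<and> diagonal (Match N :: 'k matrix_category))
     \<and>
     (\<forall>w. w permutes {1..N} \<longrightarrow>
        strict_monoidal_functor (Mat N :: 'k matrix_category) (Mat N :: 'k matrix_category)
          (\<lambda>m. m) (f_perm N w)
      \<and> strict_monoidal_functor (Match N :: 'k matrix_category) (Match N :: 'k matrix_category)
          (\<lambda>m. m) (f_perm N w))
     \<and>
     (\<forall>M \<psi>. M \<le> N \<longrightarrow> \<psi> \<in> {1..M} \<rightarrow> {1..N} \<longrightarrow> inj_on \<psi> {1..M} \<longrightarrow>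
        (\<exists>F. strict_monoidal_functor (Match N :: 'k matrix_category) (Match M :: 'k matrix_category)
               (\<lambda>m. m) F
           \<and> (\<forall>m. \<forall>A \<in> Hom (Match N :: 'k matrix_category) m m. \<forall>v \<in> words M m. \<forall>w \<in> words M m.
                F m m A v w = A (map \<psi> v) (map \<psi> w))))"
proof (intro conjI allI impI)
  show "monoidal_subcategory (Match N :: 'k matrix_category) (Mat N)"
    by (rule monoidal_subcategory_Match)
  show "diagonal (Match N :: 'k matrix_category)"
    by (rule diagonal_Match)
next
  fix w
  assume w: "w permutes {1..N}"
  then have inv: "inv w permutes {1..N}"
    by (rule permutes_inv)
  show "strict_monoidal_functor (Mat N :: 'k matrix_category) (Mat N) (\<lambda>m. m) (f_perm N w)"
    unfolding f_perm_eq_relabel[OF w] by (rule strict_monoidal_functor_relabel_Mat[OF inv])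
  \<comment> \<open>On charge-conserving matrices this is the case \<open>M = N\<close> of (III),
    with \<open>inv w\<close> as the injection.\<close>
  show "strict_monoidal_functor (Match N :: 'k matrix_category) (Match N) (\<lambda>m. m) (f_perm N w)"
    unfolding f_perm_eq_relabel[OF w]
    by (rule strict_monoidal_functor_relabel_Match[OF permutes_funcset[OF inv] permutes_inj_on[OF inv]])
next
  fix M :: nat and \<psi> :: "nat \<Rightarrow> nat"
  assume "\<psi> \<in> {1..M} \<rightarrow> {1..N}" "inj_on \<psi> {1..M}"
  then show "\<exists>F. strict_monoidal_functor (Match N :: 'k matrix_category) (Match M :: 'k matrix_category)
               (\<lambda>m. m) F
           \<and> (\<forall>m. \<forall>A \<in> Hom (Match N :: 'k matrix_category) m m. \<forall>v \<in> words M m. \<forall>w \<in> words M m.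
                F m m A v w = A (map \<psi> v) (map \<psi> w))"
    by (intro exI[of _ "relabel M \<psi>"] conjI strict_monoidal_functor_relabel_Match)
      (auto simp: relabel_def)
qed

end
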